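(* For every randomized synchronous mutual search protocol for two agents on $n\ge 2$ sites that uses a bounded number of coin flips, the worst-case expected cost is at least $\frac{n-1}{8}$.
   Context: Sites are $V=\{0,\ldots,n-1\}$; two agents sit at two distinct sites and search for each other by queries "is there an agent at site $j$?". Time is discrete, with slots $t=1,2,\ldots$. A randomized synchronous mutual search protocol using a bounded number of coin flips is given by a number $b=b(n)$ and, for every site $i$ and every coin-flip string $\omega\in\{0,1\}^b$, a finite sequence $A(i,\omega)=(q_1,q_2,\ldots)$ with each $q_t\in\{\perp\}\cup(V\setminus\{i\})$, where $q_t=j$ means that an agent at $i$ with coin flips $\omega$ queries site $j$ in slot $t$, and $q_t=\perp$ means it makes no query in slot $t$ (before contact every answer is "no", so the schedule does not depend on answers). Both agents run this same protocol, each drawing its own string $\omega$ independently and uniformly at random. It is required that for all distinct sites $i,j$ and all $\omega,\omega'$, in each time slot at most one of $A(i,\omega)$, $A(j,\omega')$ has a non-$\perp$ entry, and that some slot contains a query of one of the two agents to the other's site. The cost of an execution with agents at $i,j$ using $\omega,\omega'$ is the number of non-$\perp$ queries of both agents in slots up to and including the first slot $t_0$ in which one agent queries the other's site. The worst-case expected cost of the protocol is the maximum over all placements $\{i,j\}$ of the expected cost over the random strings. *)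

theory Defs
  imports "HOL-Probability.Probability"
begin

text \<open>
  The sites are \<open>{..<n}\<close>. A schedule is a finite list whose entry at list index \<open>t - 1\<close> belongs to
  time slot \<open>t\<close>, for \<open>t = 1, 2, \<dots>\<close>; \<^term>\<open>None\<close> stands for ``no query''. An agent makes no query in
  slots after the end of its schedule.
\<close>

type_synonym schedule = "nat option list"

type_synonym protocol = "nat \<Rightarrow> bool list \<Rightarrow> schedule"

definition coin_strings :: "nat \<Rightarrow> bool list set" where
  "coin_strings b = {\<omega>. length \<omega> = b}"

definition query :: "schedule \<Rightarrow> nat \<Rightarrow> nat option" where
  "query q t = (if 1 \<le> t \<and> t \<le> length q then q ! (t - 1) else None)"

definition contact :: "protocol \<Rightarrow> nat \<Rightarrow> bool list \<Rightarrow> nat \<Rightarrow> bool list \<Rightarrow> nat \<Rightarrow> bool" where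
  "contact A i \<omega> j \<omega>' t \<longleftrightarrow> query (A i \<omega>) t = Some j \<or> query (A j \<omega>') t = Some i"

definition mutual_search_protocol :: "nat \<Rightarrow> nat \<Rightarrow> protocol \<Rightarrow> bool" where
  "mutual_search_protocol n b A \<longleftrightarrow>
     (\<forall>i<n. \<forall>\<omega>\<in>coin_strings b. set (A i \<omega>) \<subseteq> {None} \<union> Some ` ({..<n} - {i})) \<and>
     (\<forall>i<n. \<forall>j<n. i \<noteq> j \<longrightarrow> (\<forall>\<omega>\<in>coin_strings b. \<forall>\<omega>'\<in>coin_strings b.
        (\<forall>t. query (A i \<omega>) t = None \<or> query (A j \<omega>') t = None) \<and>
        (\<exists>t. contact A i \<omega> j \<omega>' t)))"

definition contact_slot :: "protocol \<Rightarrow> nat \<Rightarrow> bool list \<Rightarrow> nat \<Rightarrow> bool list \<Rightarrow> nat" where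
  "contact_slot A i \<omega> j \<omega>' = (LEAST t. contact A i \<omega> j \<omega>' t)"

definition num_queries :: "schedule \<Rightarrow> nat \<Rightarrow> nat" where
  "num_queries q T = card {t \<in> {1..T}. query q t \<noteq> None}"

definition cost :: "protocol \<Rightarrow> nat \<Rightarrow> bool list \<Rightarrow> nat \<Rightarrow> bool list \<Rightarrow> nat" where
  "cost A i \<omega> j \<omega>' =
     num_queries (A i \<omega>) (contact_slot A i \<omega> j \<omega>') +
     num_queries (A j \<omega>') (contact_slot A i \<omega> j \<omega>')"

definition expected_cost :: "nat \<Rightarrow> protocol \<Rightarrow> nat \<Rightarrow> nat \<Rightarrow> real" where
  "expected_cost b A i j =
     measure_pmf.expectation
       (pair_pmf (pmf_of_set (coin_strings b)) (pmf_of_set (coin_strings b)))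
       (\<lambda>(\<omega>, \<omega>'). real (cost A i \<omega> j \<omega>'))"

text \<open>
  A placement is represented by both of its orderings \<open>(i, j)\<close> and \<open>(j, i)\<close>; these have the same
  expected cost. The set of placements is nonempty exactly when \<open>n \<ge> 2\<close>.
\<close>

definition worst_case_expected_cost :: "nat \<Rightarrow> nat \<Rightarrow> protocol \<Rightarrow> real" where
  "worst_case_expected_cost n b A = Max {expected_cost b A i j | i j. i < n \<and> j < n \<and> i \<noteq> j}"

end

theory Submission
  imports Defs
begin

text \<open>
  A query of one agent can only rule out one site, so for a fixed coin-flip string its first \<open>K\<close>
  queries reach at most \<open>K\<close> sites. For a uniformly random placement an execution therefore has cost
  at most \<open>K\<close> with probability at most \<open>2 * K / (n - 1)\<close>; choosing \<open>K\<close> near \<open>(n - 1) / 4\<close> makes this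
  at most one half.
\<close>

text \<open>The count at slot \<open>t\<close> includes the query made at \<open>t\<close> itself,
  so these are the targets of the first \<open>K\<close> queries. The set depends on one agent's
  schedule alone, hence only on that agent's own coin flips.\<close>

definition early_targets :: "nat \<Rightarrow> schedule \<Rightarrow> nat set" where
  "early_targets K q = {j. \<exists>t. query q t = Some j \<and> num_queries q t \<le> K}"

lemma num_queries_less:
  assumes "s < t" "query q t \<noteq> None"
  shows "num_queries q s < num_queries q t"
proof -
  have "1 \<le> t"
    using assms(2) by (auto simp: query_def split: if_splits)
  then have "t \<in> {r \<in> {1..t}. query q r \<noteq> None} - {r \<in> {1..s}. query q r \<noteq> None}"
    using assms by simp
  moreover have "{r \<in> {1..s}. query q r \<noteq> None} \<subseteq> {r \<in> {1..t}. query q r \<noteq> None}"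
    using assms(1) by auto
  ultimately show ?thesis
    unfolding num_queries_def by (intro psubset_card_mono psubsetI) auto
qed

text \<open>The running count strictly increases from one query slot to the next, so it numbers the
  relevant slots injectively within \<open>{1..K}\<close>, and each slot names a single
  target.\<close>

lemma card_early_targets:
  "finite (early_targets K q) \<and> card (early_targets K q) \<le> K"
proof -
  define T where "T = {t. query q t \<noteq> None \<and> num_queries q t \<le> K}"
  have inj: "inj_on (num_queries q) T"
  proof (rule inj_onI)
    fix s t assume "s \<in> T" "t \<in> T" "num_queries q s = num_queries q t"
    then show "s = t"
      unfolding T_def
      by (metis (mono_tags, lifting) linorder_neqE_nat mem_Collect_eq nat_less_le num_queries_less)
  qed
  have sub: "num_queries q ` T \<subseteq> {1..K}"
  proof
    fix m assume "m \<in> num_queries q ` T"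
    then obtain t where t: "query q t \<noteq> None" "num_queries q t \<le> K" "m = num_queries q t"
      by (auto simp: T_def)
    \<comment> \<open>\<open>query\<close> is \<open>None\<close> at slot 0 by default, so a query
      slot lies strictly after 0 and its count is at least 1.\<close>
    then have "t > 0"
      by (auto simp: query_def split: if_splits)
    with t num_queries_less[of 0 t q] show "m \<in> {1..K}"
      by simp
  qed
  have "finite T"
    using inj sub finite_imageD finite_subset by blast
  moreover have "card T \<le> K"
    using card_inj_on_le[OF inj sub] by simp
  moreover have "early_targets K q = (\<lambda>t. the (query q t)) ` T"
    by (force simp: early_targets_def T_def)
  ultimately show ?thesis
    by (metis card_image_le finite_imageI le_trans)
qed

lemma mutual_search_protocol_contact_slot:
  assumes "mutual_search_protocol n b A" "i < n" "j < n" "i \<noteq> j"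
    and "\<omega> \<in> coin_strings b" "\<omega>' \<in> coin_strings b"
  shows "contact A i \<omega> j \<omega>' (contact_slot A i \<omega> j \<omega>')"
proof -
  have "\<exists>t. contact A i \<omega> j \<omega>' t"
    using assms unfolding mutual_search_protocol_def by blast
  then show ?thesis
    unfolding contact_slot_def by (rule LeastI_ex)
qed

text \<open>The bound is linear in the two indicators, so taking expectations turns it into a union
  bound. It is trivial when an indicator is 1, since the right side is then at most 0.\<close>

lemma cost_ge:
  assumes "mutual_search_protocol n b A" "i < n" "j < n" "i \<noteq> j"
    and "\<omega> \<in> coin_strings b" "\<omega>' \<in> coin_strings b"
  shows "real (cost A i \<omega> j \<omega>') \<ge>
    (real K + 1) * (1 - of_bool (j \<in> early_targets K (A i \<omega>)) - of_bool (i \<in> early_targets K (A j \<omega>')))"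
proof (cases "j \<in> early_targets K (A i \<omega>) \<or> i \<in> early_targets K (A j \<omega>')")
  case True
  then have "(real K + 1) * (1 - of_bool (j \<in> early_targets K (A i \<omega>))
      - of_bool (i \<in> early_targets K (A j \<omega>'))) \<le> 0"
    by auto
  then show ?thesis
    by linarith
next
  case False
  \<comment> \<open>The query that makes contact is not among the first \<open>K\<close> of the
    agent asking it, so that agent alone has already made \<open>K + 1\<close> queries.\<close>
  with mutual_search_protocol_contact_slot[OF assms] have "K + 1 \<le> cost A i \<omega> j \<omega>'"
    unfolding contact_def early_targets_def cost_def by force
  with False show ?thesis
    by simp
qed

lemma finite_coin_strings: "finite (coin_strings b)"
  using finite_lists_length_eq[of "UNIV :: bool set" b] by (simp add: coin_strings_def)

lemma coin_strings_nonempty: "coin_strings b \<noteq> {}"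
  unfolding coin_strings_def by (auto intro: Ex_list_of_length)

definition early_prob :: "nat \<Rightarrow> nat \<Rightarrow> protocol \<Rightarrow> nat \<Rightarrow> nat \<Rightarrow> real" where
  "early_prob b K A i j =
     measure_pmf.prob (pmf_of_set (coin_strings b)) {\<omega>. j \<in> early_targets K (A i \<omega>)}"

text \<open>By linearity the sum is the expected number of sites of \<open>J\<close> among the early
  targets, and this number is at most \<open>K\<close> for every coin string.\<close>

lemma sum_early_prob_le:
  assumes "finite J"
  shows "(\<Sum>j\<in>J. early_prob b K A i j) \<le> real K"
proof -
  let ?p = "measure_pmf (pmf_of_set (coin_strings b))"
  have [simp]: "integrable ?p f" for f :: "bool list \<Rightarrow> real"
    by (rule integrable_measure_pmf_finite) (simp add: finite_coin_strings coin_strings_nonempty)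
  have "(\<Sum>j\<in>J. early_prob b K A i j) =
      (\<Sum>j\<in>J. \<integral>\<omega>. indicator {\<omega>. j \<in> early_targets K (A i \<omega>)} \<omega> \<partial>?p)"
    by (simp add: early_prob_def)
  also have "\<dots> = (\<integral>\<omega>. (\<Sum>j\<in>J. indicator {\<omega>. j \<in> early_targets K (A i \<omega>)} \<omega>) \<partial>?p)"
    by (subst Bochner_Integration.integral_sum) simp_all
  also have "\<dots> = (\<integral>\<omega>. real (card (J \<inter> early_targets K (A i \<omega>))) \<partial>?p)"
    using assms by (simp add: indicator_def Int_def flip: sum.inter_filter)
  also have "\<dots> \<le> (\<integral>\<omega>. real K \<partial>?p)"
  proof (rule integral_mono)
    fix \<omega>
    have "card (J \<inter> early_targets K (A i \<omega>)) \<le> K"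
      using card_early_targets[of K "A i \<omega>"]
      by (meson Int_lower2 card_mono le_trans)
    then show "real (card (J \<inter> early_targets K (A i \<omega>))) \<le> real K"
      by simp
  qed simp_all
  finally show ?thesis
    by simp
qed

lemma expected_cost_ge:
  assumes "mutual_search_protocol n b A" "i < n" "j < n" "i \<noteq> j"
  shows "expected_cost b A i j \<ge> (real K + 1) * (1 - early_prob b K A i j - early_prob b K A j i)"
proof -
  let ?p = "pmf_of_set (coin_strings b)"
  let ?pp = "pair_pmf ?p ?p"
  let ?X = "{\<omega>. j \<in> early_targets K (A i \<omega>)}" and ?Y = "{\<omega>. i \<in> early_targets K (A j \<omega>)}"
  have set_p: "set_pmf ?p = coin_strings b"
    by (simp add: finite_coin_strings coin_strings_nonempty)
  have int: "integrable (measure_pmf ?pp) f" for f :: "bool list \<times> bool list \<Rightarrow> real"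
    by (rule integrable_measure_pmf_finite) (simp add: set_p finite_coin_strings)
  \<comment> \<open>Each event constrains one coordinate of the pair only, so its probability is
    that of a uniform single string.\<close>
  have X: "measure_pmf.prob ?pp (fst -` ?X) = early_prob b K A i j"
    by (simp only: early_prob_def map_fst_pair_pmf flip: measure_map_pmf)
  have Y: "measure_pmf.prob ?pp (snd -` ?Y) = early_prob b K A j i"
    by (simp only: early_prob_def map_snd_pair_pmf flip: measure_map_pmf)
  have "(real K + 1) * (1 - early_prob b K A i j - early_prob b K A j i) =
      (\<integral>x. (real K + 1) * (1 - indicator (fst -` ?X) x - indicator (snd -` ?Y) x) \<partial>?pp)"
    by (simp add: int flip: X Y)
  also have "\<dots> \<le> (\<integral>x. (case x of (\<omega>, \<omega>') \<Rightarrow> real (cost A i \<omega> j \<omega>')) \<partial>?pp)"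
    using cost_ge[OF assms, of _ _ K]
    by (intro integral_mono_AE int) (auto simp: AE_measure_pmf_iff set_p indicator_def of_bool_def)
  finally show ?thesis
    by (simp add: expected_cost_def)
qed

theorem theorem5:
  fixes n b :: nat and A :: protocol
  assumes "n \<ge> 2"
    and "mutual_search_protocol n b A"
  shows "worst_case_expected_cost n b A \<ge> (real n - 1) / 8"
proof -
  \<comment> \<open>The averaged bound is governed by \<open>(K + 1) * (n - 1 - 2 * K)\<close>. For
    real \<open>x\<close>, the product \<open>x * (n - 1 - 2 * x)\<close> peaks at
    \<open>x = (n - 1) / 4\<close> with value \<open>(n - 1)^2 / 8\<close>.\<close>
  define K where "K = (n - 1) div 4"
  define W where "W = worst_case_expected_cost n b A"
  define P where "P = (SIGMA i:{..<n}. {..<n} - {i})"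
  let ?p = "early_prob b K A"
  have le_W: "expected_cost b A i j \<le> W" if "i < n" "j < n" "i \<noteq> j" for i j
  proof -
    have "{expected_cost b A i j | i j. i < n \<and> j < n \<and> i \<noteq> j}
        \<subseteq> (\<lambda>(i, j). expected_cost b A i j) ` ({..<n} \<times> {..<n})"
      by auto
    then have "finite {expected_cost b A i j | i j. i < n \<and> j < n \<and> i \<noteq> j}"
      by (rule finite_subset) simp
    with that show ?thesis
      unfolding W_def worst_case_expected_cost_def by (auto intro!: Max_ge)
  qed
  have card_P: "real (card P) = real n * (real n - 1)"
    using assms(1) by (simp add: P_def of_nat_diff)
  have sum_p: "(\<Sum>(i, j)\<in>P. ?p i j) \<le> real n * real K"
  proof -
    have "(\<Sum>(i, j)\<in>P. ?p i j) = (\<Sum>i<n. \<Sum>j\<in>{..<n} - {i}. ?p i j)"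
      unfolding P_def by (subst sum.Sigma) auto
    also have "\<dots> \<le> (\<Sum>i<n. real K)"
      by (intro sum_mono sum_early_prob_le) simp
    finally show ?thesis
      by simp
  qed
  have swap: "(\<Sum>(i, j)\<in>P. ?p j i) = (\<Sum>(i, j)\<in>P. ?p i j)"
    by (rule sum.reindex_bij_witness[of _ prod.swap prod.swap]) (auto simp: P_def)
  \<comment> \<open>Averaging: the maximum \<open>W\<close> dominates each term of a sum over all
    ordered placements, in which both families of probabilities total at most
    \<open>n * K\<close>.\<close>
  have "(real K + 1) * (card P - 2 * (real n * real K))
      \<le> (real K + 1) * (card P - (\<Sum>(i, j)\<in>P. ?p i j) - (\<Sum>(i, j)\<in>P. ?p j i))"
    using sum_p swap by (intro mult_left_mono) auto
  also have "\<dots> = (\<Sum>(i, j)\<in>P. (real K + 1) * (1 - ?p i j - ?p j i))"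
    by (simp add: case_prod_unfold sum_subtractf flip: sum_distrib_left)
  also have "\<dots> \<le> (\<Sum>(i, j)\<in>P. W)"
  proof (intro sum_mono, clarify)
    fix i j assume "(i, j) \<in> P"
    then have "i < n" "j < n" "i \<noteq> j"
      by (auto simp: P_def)
    then show "(real K + 1) * (1 - ?p i j - ?p j i) \<le> W"
      using expected_cost_ge[OF assms(2)] le_W by (meson order_trans)
  qed
  also have "\<dots> = real n * (real n - 1) * W"
    using card_P by (simp add: case_prod_unfold)
  finally have "real n * ((real K + 1) * (real n - 1 - 2 * real K)) \<le> real n * ((real n - 1) * W)"
    unfolding card_P by (simp add: algebra_simps)
  then have bound: "(real K + 1) * (real n - 1 - 2 * real K) \<le> (real n - 1) * W"
    using assms(1) by simp
  \<comment> \<open>Rounding down costs nothing: \<open>K \<le> (n - 1) / 4\<close> bounds the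
    second factor from below, while \<open>(n - 1) / 4 \<le> K + 1\<close> bounds the first.\<close>
  have "4 * K + 1 \<le> n" "n \<le> 4 * (K + 1) + 1"
    using assms(1) unfolding K_def by auto
  then have "4 * real K \<le> real n - 1" "real n - 1 \<le> 4 * (real K + 1)"
    by (simp_all flip: of_nat_le_iff[where 'a = real])
  then have "(real n - 1) / 4 * ((real n - 1) / 2) \<le> (real K + 1) * (real n - 1 - 2 * real K)"
    using assms(1) by (intro mult_mono) auto
  with bound have "(real n - 1) * ((real n - 1) / 8) \<le> (real n - 1) * W"
    by simp
  then show ?thesis
    using assms(1) unfolding W_def by simp
qed

end
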